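(* Let $(\Omega,\Sigma,\mu)$ be a positive, complete, $\sigma$-finite measure space, $(\Omega_\alpha)_{\alpha\in I}$ a countable measurable partition of $\Omega$, $\mathcal X=(X_\alpha)_{\alpha\in I}$ a family of non-trivial Banach ideal spaces, $X_\alpha$ over $(\Omega_\alpha,\Sigma_\alpha,\mu_\alpha)$, and $E$ a Banach ideal space over the counting measure space $(I,2^I,m)$. Suppose that $E$, $E^*$ and each $X_\alpha$ ($\alpha\in I$) are order continuous, and put $\mathcal X'=(X'_\alpha)_{\alpha\in I}$. Then for all $f\in E(\mathcal X)$ and $g\in E'(\mathcal X')$ we have $fg\in L^1(\Omega,\Sigma,\mu)$ and $$\int_\Omega|fg|\,d\mu\le\|f\|_{E(\mathcal X)}\cdot\|g\|_{E'(\mathcal X')}.$$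
   Context: A Banach ideal space over $(\Omega,\Sigma,\mu)$ is a linear subspace $X$ of $L^0(\Omega,\Sigma,\mu)$ (classes of real measurable functions) with a complete norm such that (i) if $f\in L^0$, $g\in X$, $|f|\le|g|$ a.e., then $f\in X$ and $\|f\|_X\le\|g\|_X$; (ii) there is $f\in X$ strictly positive on the whole of $\Omega$. Its Köthe dual is $X'=\{g\in L^0:\|g\|_{X'}=\sup_{\|f\|_X\le1}\int|fg|\,d\mu<\infty\}$; $X^*$ is the topological dual. A normed lattice $F$ is order continuous if $\|f_n\|_F\to0$ for each sequence in $F$ with $f_n\ge f_{n+1}$, $\inf_nf_n=0$. Measurable partition: $\Omega_\alpha\in\Sigma$, $\Omega=\bigcup_{\alpha}\Omega_\alpha$ $\mu$-a.e., $\mu(\Omega_\alpha\cap\Omega_\beta)=0$ for $\alpha\ne\beta$; $\Sigma_\alpha=\{\Omega_\alpha\cap B:B\in\Sigma\}$, $\mu_\alpha=\mu|_{\Sigma_\alpha}$. Köthe-Herz space: $E(\mathcal X)=\{f\in L^0(\Omega,\Sigma,\mu): f\chi_{\Omega_\alpha}\in X_\alpha\ \forall\alpha,\ (\|f\chi_{\Omega_\alpha}\|_{X_\alpha})_\alpha\in E\}$, $\|f\|_{E(\mathcal X)}=\left\|(\|f\chi_{\Omega_\alpha}\|_{X_\alpha})_\alpha\right\|_E$; $E'(\mathcal X')$ is defined in the same way from $E'$ and $\mathcal X'$. *)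

theory Defs
  imports "HOL-Analysis.Analysis"
begin

text \<open>
  Elements of \<open>L\<^sup>0\<close> are handled through representatives: a space of classes of measurable
  functions is a set of measurable functions, and equality and order are taken almost everywhere.
  Condition \<open>ideal\<close> below forces a Banach ideal space to be saturated under a.e. equality and
  its norm to be constant on classes. For \<^term>\<open>count_space I\<close>, a.e. equality is equality on \<open>I\<close>;
  values at indices outside \<open>I\<close> are irrelevant.
\<close>

record 'f normed_carrier =
  elems :: "'f set"
  nrm :: "'f \<Rightarrow> real"

locale banach_ideal_space =
  fixes M :: "'a measure" and X :: "('a \<Rightarrow> real) normed_carrier"
  assumes measurable: "elems X \<subseteq> borel_measurable M"
    and zero_mem: "(\<lambda>x. 0) \<in> elems X"
    and add_mem: "\<And>f g. f \<in> elems X \<Longrightarrow> g \<in> elems X \<Longrightarrow> (\<lambda>x. f x + g x) \<in> elems X"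
    and scale_mem: "\<And>f c. f \<in> elems X \<Longrightarrow> (\<lambda>x. c * f x) \<in> elems X"
    and nrm_nonneg: "\<And>f. f \<in> elems X \<Longrightarrow> 0 \<le> nrm X f"
    and nrm_eq_0: "\<And>f. f \<in> elems X \<Longrightarrow> nrm X f = 0 \<longleftrightarrow> (AE x in M. f x = 0)"
    and nrm_triangle:
      "\<And>f g. f \<in> elems X \<Longrightarrow> g \<in> elems X \<Longrightarrow> nrm X (\<lambda>x. f x + g x) \<le> nrm X f + nrm X g"
    and nrm_scale: "\<And>f c. f \<in> elems X \<Longrightarrow> nrm X (\<lambda>x. c * f x) = \<bar>c\<bar> * nrm X f"
    and complete:
      "\<And>u. (\<And>n. u n \<in> elems X) \<Longrightarrow>
         (\<And>e. e > 0 \<Longrightarrow> \<exists>K. \<forall>m\<ge>K. \<forall>n\<ge>K. nrm X (\<lambda>x. u m x - u n x) < e) \<Longrightarrow>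
         \<exists>l\<in>elems X. (\<lambda>n::nat. nrm X (\<lambda>x. u n x - l x)) \<longlonglongrightarrow> 0"
    and ideal:
      "\<And>f g. f \<in> borel_measurable M \<Longrightarrow> g \<in> elems X \<Longrightarrow> (AE x in M. \<bar>f x\<bar> \<le> \<bar>g x\<bar>) \<Longrightarrow>
         f \<in> elems X \<and> nrm X f \<le> nrm X g"
    and weak_unit: "\<exists>f\<in>elems X. \<forall>x\<in>space M. f x > 0"

definition nontrivial_space :: "'a measure \<Rightarrow> ('a \<Rightarrow> real) normed_carrier \<Rightarrow> bool" where
  "nontrivial_space M X \<longleftrightarrow> (\<exists>f\<in>elems X. \<not> (AE x in M. f x = 0))"

definition kothe_sup :: "'a measure \<Rightarrow> ('a \<Rightarrow> real) normed_carrier \<Rightarrow> ('a \<Rightarrow> real) \<Rightarrow> ennreal" where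
  "kothe_sup M X g =
     (SUP f\<in>{f \<in> elems X. nrm X f \<le> 1}. \<integral>\<^sup>+ x. ennreal \<bar>f x * g x\<bar> \<partial>M)"

definition kothe_dual ::
  "'a measure \<Rightarrow> ('a \<Rightarrow> real) normed_carrier \<Rightarrow> ('a \<Rightarrow> real) normed_carrier" where
  "kothe_dual M X =
     \<lparr> elems = {g \<in> borel_measurable M. kothe_sup M X g < \<infinity>},
       nrm = (\<lambda>g. enn2real (kothe_sup M X g)) \<rparr>"

text \<open>
  Functionals are considered only on \<^term>\<open>elems X\<close>. A bounded functional automatically agrees on
  a.e. equal functions, because their difference has norm zero.
\<close>

definition topological_dual ::
  "('a \<Rightarrow> real) normed_carrier \<Rightarrow> (('a \<Rightarrow> real) \<Rightarrow> real) normed_carrier" where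
  "topological_dual X =
     \<lparr> elems = {\<phi>.
         (\<forall>f\<in>elems X. \<forall>g\<in>elems X. \<phi> (\<lambda>x. f x + g x) = \<phi> f + \<phi> g) \<and>
         (\<forall>f\<in>elems X. \<forall>c. \<phi> (\<lambda>x. c * f x) = c * \<phi> f) \<and>
         (\<exists>C. \<forall>f\<in>elems X. \<bar>\<phi> f\<bar> \<le> C * nrm X f)},
       nrm = (\<lambda>\<phi>. SUP f\<in>{f \<in> elems X. nrm X f \<le> 1}. \<bar>\<phi> f\<bar>) \<rparr>"

definition ae_le :: "'a measure \<Rightarrow> ('a \<Rightarrow> real) \<Rightarrow> ('a \<Rightarrow> real) \<Rightarrow> bool" where
  "ae_le M f g \<longleftrightarrow> (AE x in M. f x \<le> g x)"

definition dual_le ::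
  "'a measure \<Rightarrow> ('a \<Rightarrow> real) normed_carrier \<Rightarrow>
   (('a \<Rightarrow> real) \<Rightarrow> real) \<Rightarrow> (('a \<Rightarrow> real) \<Rightarrow> real) \<Rightarrow> bool" where
  "dual_le M X \<phi> \<psi> \<longleftrightarrow> (\<forall>f\<in>elems X. ae_le M (\<lambda>x. 0) f \<longrightarrow> \<phi> f \<le> \<psi> f)"

text \<open>
  The infimum of the sequence is the greatest lower bound within the lattice itself.
\<close>

definition order_continuous ::
  "'f normed_carrier \<Rightarrow> ('f \<Rightarrow> 'f \<Rightarrow> bool) \<Rightarrow> 'f \<Rightarrow> bool" where
  "order_continuous F le z \<longleftrightarrow>
     (\<forall>u :: nat \<Rightarrow> 'f.
        (\<forall>n. u n \<in> elems F) \<and>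
        (\<forall>n. le (u (Suc n)) (u n)) \<and>
        (\<forall>n. le z (u n)) \<and>
        (\<forall>h\<in>elems F. (\<forall>n. le h (u n)) \<longrightarrow> le h z)
        \<longrightarrow> (\<lambda>n. nrm F (u n)) \<longlonglongrightarrow> 0)"

definition order_continuous_space :: "'a measure \<Rightarrow> ('a \<Rightarrow> real) normed_carrier \<Rightarrow> bool" where
  "order_continuous_space M X \<longleftrightarrow> order_continuous X (ae_le M) (\<lambda>x. 0)"

definition order_continuous_dual :: "'a measure \<Rightarrow> ('a \<Rightarrow> real) normed_carrier \<Rightarrow> bool" where
  "order_continuous_dual M X \<longleftrightarrow>
     order_continuous (topological_dual X) (dual_le M X) (\<lambda>f. 0)"

definition measurable_partition :: "'a measure \<Rightarrow> 'i set \<Rightarrow> ('i \<Rightarrow> 'a set) \<Rightarrow> bool" where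
  "measurable_partition M I \<Omega> \<longleftrightarrow>
     (\<forall>\<alpha>\<in>I. \<Omega> \<alpha> \<in> sets M) \<and>
     (AE x in M. x \<in> (\<Union>\<alpha>\<in>I. \<Omega> \<alpha>)) \<and>
     (\<forall>\<alpha>\<in>I. \<forall>\<beta>\<in>I. \<alpha> \<noteq> \<beta> \<longrightarrow> emeasure M (\<Omega> \<alpha> \<inter> \<Omega> \<beta>) = 0)"

definition norm_seq ::
  "('i \<Rightarrow> 'a set) \<Rightarrow> ('i \<Rightarrow> ('a \<Rightarrow> real) normed_carrier) \<Rightarrow> ('a \<Rightarrow> real) \<Rightarrow> 'i \<Rightarrow> real" where
  "norm_seq \<Omega> X f = (\<lambda>\<alpha>. nrm (X \<alpha>) (\<lambda>x. f x * indicator (\<Omega> \<alpha>) x))"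

definition kothe_herz ::
  "'a measure \<Rightarrow> 'i set \<Rightarrow> ('i \<Rightarrow> 'a set) \<Rightarrow> ('i \<Rightarrow> real) normed_carrier \<Rightarrow>
   ('i \<Rightarrow> ('a \<Rightarrow> real) normed_carrier) \<Rightarrow> ('a \<Rightarrow> real) normed_carrier" where
  "kothe_herz M I \<Omega> E X =
     \<lparr> elems = {f \<in> borel_measurable M.
         (\<forall>\<alpha>\<in>I. (\<lambda>x. f x * indicator (\<Omega> \<alpha>) x) \<in> elems (X \<alpha>)) \<and>
         norm_seq \<Omega> X f \<in> elems E},
       nrm = (\<lambda>f. nrm E (norm_seq \<Omega> X f)) \<rparr>"

end

theory Submission
  imports Defs
begin

text \<open>
  The estimate is Hoelder's inequality for a space and its Koethe dual, used twice. On a single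
  piece \<open>\<Omega> \<alpha>\<close> it bounds \<open>\<integral>\<bar>f g\<bar>\<close> by \<open>a \<alpha> * b \<alpha>\<close>, where \<open>a\<close> and \<open>b\<close> are the sequences of norms of
  the pieces of \<open>f\<close> and \<open>g\<close>. Since the countably many pieces cover the space, the integral over the
  whole space is at most \<open>\<Sum>\<alpha>. a \<alpha> * b \<alpha>\<close>, and the same inequality for the sequence space \<open>E\<close> bounds
  this sum by the product of the norms of \<open>a\<close> and \<open>b\<close>. Everything is carried out with nonnegative
  integrals in \<^typ>\<open>ennreal\<close>, so that integrability of \<open>f g\<close> comes out of the final bound
  (lemmas \<open>kothe_dual_Hoelder\<close> and \<open>nn_integral_le_sum_of_pieces\<close>).
\<close>

text \<open>
  If \<open>f\<close> has positive norm, this is the definition of the dual norm, tested on \<open>f\<close> divided by its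
  norm. If \<open>f\<close> has norm zero, normalising is impossible, but then \<open>f\<close> vanishes almost everywhere.
\<close>

lemma kothe_dual_Hoelder:
  assumes X: "banach_ideal_space M X"
    and f: "f \<in> elems X" and g: "g \<in> elems (kothe_dual M X)"
  shows "(\<integral>\<^sup>+ x. ennreal \<bar>f x * g x\<bar> \<partial>M) \<le> ennreal (nrm X f * nrm (kothe_dual M X) g)"
proof -
  interpret banach_ideal_space M X by (rule X)
  define c where "c = nrm X f"
  have c0: "0 \<le> c" using nrm_nonneg[OF f] by (simp add: c_def)
  have [measurable]: "f \<in> borel_measurable M" using f measurable by auto
  have [measurable]: "g \<in> borel_measurable M" and fin: "kothe_sup M X g < \<infinity>"
    using g by (auto simp: kothe_dual_def)
  show ?thesis
  proof (cases "c = 0")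
    case True
    then have "AE x in M. f x = 0" using nrm_eq_0[OF f] by (simp add: c_def)
    then have "AE x in M. ennreal \<bar>f x * g x\<bar> = 0" by (rule AE_mp) auto
    then have "(\<integral>\<^sup>+ x. ennreal \<bar>f x * g x\<bar> \<partial>M) = 0" by (subst nn_integral_0_iff_AE) auto
    then show ?thesis by simp
  next
    case False
    with c0 have c: "0 < c" by simp
    let ?h = "\<lambda>x. (1 / c) * f x"
    have "?h \<in> {f \<in> elems X. nrm X f \<le> 1}"
      using scale_mem[OF f, of "1 / c"] nrm_scale[OF f, of "1 / c"] c by (simp add: c_def)
    then have le: "(\<integral>\<^sup>+ x. ennreal \<bar>?h x * g x\<bar> \<partial>M) \<le> kothe_sup M X g"
      unfolding kothe_sup_def by (rule SUP_upper)
    have "ennreal \<bar>f x * g x\<bar> = ennreal c * ennreal \<bar>?h x * g x\<bar>" for x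
      using c by (simp flip: ennreal_mult add: abs_mult)
    then have "(\<integral>\<^sup>+ x. ennreal \<bar>f x * g x\<bar> \<partial>M)
        = ennreal c * (\<integral>\<^sup>+ x. ennreal \<bar>?h x * g x\<bar> \<partial>M)"
      by (simp only:) (rule nn_integral_cmult, measurable)
    also have "\<dots> \<le> ennreal c * kothe_sup M X g"
      by (rule mult_left_mono[OF le]) simp
    also have "\<dots> = ennreal (c * enn2real (kothe_sup M X g))"
      using fin c by (simp add: ennreal_mult)
    finally show ?thesis by (simp add: c_def kothe_dual_def)
  qed
qed

text \<open>
  At almost every point at least one of the indicators equals 1, so the function is dominated by
  the sum of its pieces; countability of the index set lets sum and integral be exchanged.
\<close>

lemma nn_integral_le_sum_of_pieces:
  fixes h :: "'a \<Rightarrow> ennreal"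
  assumes I: "countable I" and A: "\<And>i. i \<in> I \<Longrightarrow> A i \<in> sets M"
    and cover: "AE x in M. x \<in> (\<Union>i\<in>I. A i)" and h: "h \<in> borel_measurable M"
  shows "(\<integral>\<^sup>+ x. h x \<partial>M) \<le> (\<integral>\<^sup>+ i. (\<integral>\<^sup>+ x. h x \<partial>restrict_space M (A i)) \<partial>count_space I)"
proof -
  have "AE x in M. h x \<le> (\<integral>\<^sup>+ i. h x * indicator (A i) x \<partial>count_space I)"
    using cover
  proof (rule AE_mp, intro AE_I2 impI)
    fix x assume "x \<in> (\<Union>i\<in>I. A i)"
    then obtain i where i: "i \<in> I" "x \<in> A i" by auto
    have "h x * indicator (A i) x \<le> (\<integral>\<^sup>+ i. h x * indicator (A i) x \<partial>count_space I)"
      using i(1) by (rule nn_integral_ge_point)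
    then show "h x \<le> (\<integral>\<^sup>+ i. h x * indicator (A i) x \<partial>count_space I)"
      using i(2) by simp
  qed
  then have "(\<integral>\<^sup>+ x. h x \<partial>M)
      \<le> (\<integral>\<^sup>+ x. (\<integral>\<^sup>+ i. h x * indicator (A i) x \<partial>count_space I) \<partial>M)"
    by (rule nn_integral_mono_AE)
  also have "\<dots> = (\<integral>\<^sup>+ i. (\<integral>\<^sup>+ x. h x * indicator (A i) x \<partial>M) \<partial>count_space I)"
    using I A h by (intro nn_integral_count_space_nn_integral) auto
  also have "\<dots> = (\<integral>\<^sup>+ i. (\<integral>\<^sup>+ x. h x \<partial>restrict_space M (A i)) \<partial>count_space I)"
    using A by (intro nn_integral_cong) (simp add: nn_integral_restrict_space)
  finally show ?thesis .
qed

theorem proposition3p16: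
  fixes M :: "'a measure" and I :: "'i set" and \<Omega> :: "'i \<Rightarrow> 'a set"
    and X :: "'i \<Rightarrow> ('a \<Rightarrow> real) normed_carrier"
    and E :: "('i \<Rightarrow> real) normed_carrier"
    and f g :: "'a \<Rightarrow> real"
  assumes "complete_measure M"
    and "sigma_finite_measure M"
    and "countable I"
    and "measurable_partition M I \<Omega>"
    and "\<And>\<alpha>. \<alpha> \<in> I \<Longrightarrow> banach_ideal_space (restrict_space M (\<Omega> \<alpha>)) (X \<alpha>)"
    and "\<And>\<alpha>. \<alpha> \<in> I \<Longrightarrow> nontrivial_space (restrict_space M (\<Omega> \<alpha>)) (X \<alpha>)"
    and "banach_ideal_space (count_space I) E"
    and "order_continuous_space (count_space I) E"
    and "order_continuous_dual (count_space I) E"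
    and "\<And>\<alpha>. \<alpha> \<in> I \<Longrightarrow> order_continuous_space (restrict_space M (\<Omega> \<alpha>)) (X \<alpha>)"
    and "f \<in> elems (kothe_herz M I \<Omega> E X)"
    and "g \<in> elems (kothe_herz M I \<Omega> (kothe_dual (count_space I) E)
                     (\<lambda>\<alpha>. kothe_dual (restrict_space M (\<Omega> \<alpha>)) (X \<alpha>)))"
  shows "integrable M (\<lambda>x. f x * g x) \<and>
    (\<integral>x. \<bar>f x * g x\<bar> \<partial>M)
      \<le> nrm (kothe_herz M I \<Omega> E X) f *
        nrm (kothe_herz M I \<Omega> (kothe_dual (count_space I) E)
               (\<lambda>\<alpha>. kothe_dual (restrict_space M (\<Omega> \<alpha>)) (X \<alpha>))) g"
proof -
  let ?R = "\<lambda>\<alpha>. restrict_space M (\<Omega> \<alpha>)"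
  let ?Y = "\<lambda>\<alpha>. kothe_dual (?R \<alpha>) (X \<alpha>)"
  let ?F = "kothe_dual (count_space I) E"
  let ?a = "norm_seq \<Omega> X f" and ?b = "norm_seq \<Omega> ?Y g"
  let ?h = "\<lambda>x. ennreal \<bar>f x * g x\<bar>"
  let ?K = "nrm E ?a * nrm ?F ?b"
  have \<Omega>: "\<Omega> \<alpha> \<in> sets M" if "\<alpha> \<in> I" for \<alpha>
    using assms(4) that by (auto simp: measurable_partition_def)
  have cover: "AE x in M. x \<in> (\<Union>\<alpha>\<in>I. \<Omega> \<alpha>)"
    using assms(4) by (simp add: measurable_partition_def)
  have [measurable]: "f \<in> borel_measurable M" and a: "?a \<in> elems E"
    and fX: "\<And>\<alpha>. \<alpha> \<in> I \<Longrightarrow> (\<lambda>x. f x * indicator (\<Omega> \<alpha>) x) \<in> elems (X \<alpha>)"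
    using assms(11) by (auto simp: kothe_herz_def)
  have [measurable]: "g \<in> borel_measurable M" and b: "?b \<in> elems ?F"
    and gX: "\<And>\<alpha>. \<alpha> \<in> I \<Longrightarrow> (\<lambda>x. g x * indicator (\<Omega> \<alpha>) x) \<in> elems (?Y \<alpha>)"
    using assms(12) by (auto simp: kothe_herz_def)
  have K: "0 \<le> ?K"
    using banach_ideal_space.nrm_nonneg[OF assms(7) a] by (simp add: kothe_dual_def)
  have piece: "(\<integral>\<^sup>+ x. ?h x \<partial>?R \<alpha>) \<le> ennreal \<bar>?a \<alpha> * ?b \<alpha>\<bar>" if \<alpha>: "\<alpha> \<in> I" for \<alpha>
  proof -
    have "(\<integral>\<^sup>+ x. ?h x \<partial>?R \<alpha>)
        = (\<integral>\<^sup>+ x. ennreal \<bar>(f x * indicator (\<Omega> \<alpha>) x) * (g x * indicator (\<Omega> \<alpha>) x)\<bar> \<partial>?R \<alpha>)"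
      by (intro nn_integral_cong) (simp add: space_restrict_space)
    also have "\<dots> \<le> ennreal (?a \<alpha> * ?b \<alpha>)"
      using kothe_dual_Hoelder[OF assms(5)[OF \<alpha>] fX[OF \<alpha>] gX[OF \<alpha>]] by (simp add: norm_seq_def)
    also have "\<dots> \<le> ennreal \<bar>?a \<alpha> * ?b \<alpha>\<bar>" by (intro ennreal_leI) simp
    finally show ?thesis .
  qed
  have "(\<integral>\<^sup>+ x. ?h x \<partial>M) \<le> (\<integral>\<^sup>+ \<alpha>. (\<integral>\<^sup>+ x. ?h x \<partial>?R \<alpha>) \<partial>count_space I)"
    by (rule nn_integral_le_sum_of_pieces[OF assms(3) \<Omega> cover]) auto
  also have "\<dots> \<le> (\<integral>\<^sup>+ \<alpha>. ennreal \<bar>?a \<alpha> * ?b \<alpha>\<bar> \<partial>count_space I)"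
    by (intro nn_integral_mono) (simp add: piece)
  also have "\<dots> \<le> ennreal ?K"
    by (rule kothe_dual_Hoelder[OF assms(7) a b])
  finally have bound: "(\<integral>\<^sup>+ x. ?h x \<partial>M) \<le> ennreal ?K" .
  have "integrable M (\<lambda>x. f x * g x)"
    using le_less_trans[OF bound ennreal_less_top] by (intro integrableI_bounded) auto
  moreover have "(\<integral>x. \<bar>f x * g x\<bar> \<partial>M) \<le> ?K"
    using enn2real_mono[OF bound] K by (subst integral_eq_nn_integral) auto
  ultimately show ?thesis by (simp add: kothe_herz_def)
qed

end
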